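(* Let $(X,\rho,\mu)$ be a space of homogeneous type (with the standing assumptions listed in the context), $q\in(1,\infty)$, and $\gamma,\gamma'\in[0,1)$. (i) If $0\le\gamma\le\gamma'<1$, then $A^+_q(\gamma)\subset A^+_q(\gamma')$. (ii) If $0<\gamma'<\gamma<1$, then $A^+_q(\gamma)\subset A^+_q(\gamma')$.
   Context: Setting. $(X,\rho)$ is a quasi-metric space: $\rho:X\times X\to[0,\infty)$, $\rho(x,y)=0$ iff $x=y$, $\rho(x,y)=\rho(y,x)$, and $\rho(x,y)\le K_0[\rho(x,z)+\rho(z,y)]$ for all $x,y,z\in X$, with a constant $K_0\in[1,\infty)$. Balls are $B(x,r)=\{y\in X:\rho(x,y)<r\}$. $\mu$ is a nonnegative measure on a $\sigma$-algebra containing the balls which is doubling: $\mu(B(x,2r))\le C_\mu\mu(B(x,r))$ for all $x\in X$, $r\in(0,\infty)$; then $(X,\rho,\mu)$ is called a space of homogeneous type. Standing assumptions: (a) for each $x$ the balls $\{B(x,r)\}_{r>0}$ form a basis of open neighborhoods of $x$; (b) $\mu$ is Borel regular (open sets are measurable and every $A\subset X$ lies in a Borel set $E$ with $\mu(A)=\mu(E)$); (c) $0<\mu(B(x,r))<\infty$ for all balls; (d) $\operatorname{diam}(X)=\infty$ and $\mu(\{x\})=0$ for all $x$; (e) monotone geodesic property: there is a constant $\widetilde K>0$ such that for all $s\in(0,\infty)$ and $x,y\in X$ with $\rho(x,y)\ge s$ there are $m\in\mathbb N$ and points $x_0=x,x_1,\dots,x_m=y$ with $\rho(x_i,x_{i+1})\le\widetilde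 K s$ and $\rho(x_{i+1},x_m)\le\rho(x_i,x_m)-s$ for $i=0,\dots,m-1$. Fix $p\in(1,\infty)$. $X\times\mathbb R$ carries the quasi-metric $d((x,t),(y,s))=\max\{\rho(x,y),|t-s|^{1/p}\}$ and the product measure $\lambda=\mu\times m$, $m$ being Lebesgue measure on $\mathbb R$; the same basic assumptions (a)-(d) are made for $(X\times\mathbb R,d,\lambda)$. All integrals are with respect to $\lambda$, and $⨍_E f:=\frac1{\lambda(E)}\int_E f$ denotes the average. Parabolic cylinders. For $x\in X$, $t\in\mathbb R$, $l\in(0,\infty)$, $\gamma\in[0,1)$ put $R=R(x,t,l)=B(x,l)\times(t-l^p,t+l^p)$, $R^-(\gamma)=B(x,l)\times(t-l^p,t-\gamma l^p)$, $R^+(\gamma)=B(x,l)\times(t+\gamma l^p,t+l^p)$. Weights. A weight is a real-valued, $\lambda$-almost everywhere positive, locally integrable function on $X\times\mathbb R$ (integrable on some cylinder $R(x,t,r)$ around each point). For $q\in(1,\infty)$, with $1/q+1/q'=1$, and $\gamma\in[0,1)$, a weight $\omega$ belongs to $A^+_q(\gamma)$ if $\sup_{R}\left[⨍_{R^-(\gamma)}\omega\right]\left[⨍_{R^+(\gamma)}\omega^{1-q'}\right]^{q-1}<\infty$, the supremum being over all parabolic cylinders $R(x,t,l)$. *)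

theory Defs
  imports "HOL-Analysis.Analysis"
begin

section \<open>Spaces of homogeneous type\<close>

text \<open>The underlying set of a space is the whole type.\<close>

locale quasi_metric =
  fixes \<rho> :: "'a \<Rightarrow> 'a \<Rightarrow> real"
  assumes nonneg: "0 \<le> \<rho> x y"
    and eq_0_iff: "\<rho> x y = 0 \<longleftrightarrow> x = y"
    and sym: "\<rho> x y = \<rho> y x"
    and quasi_triangle: "\<exists>K\<^sub>0\<ge>1. \<forall>x y z. \<rho> x y \<le> K\<^sub>0 * (\<rho> x z + \<rho> z y)"

definition qball :: "('a \<Rightarrow> 'a \<Rightarrow> real) \<Rightarrow> 'a \<Rightarrow> real \<Rightarrow> 'a set" where
  "qball \<rho> x r = {y. \<rho> x y < r}"

locale homogeneous_type_space = quasi_metric \<rho> for \<rho> :: "'a \<Rightarrow> 'a \<Rightarrow> real" +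
  fixes \<mu> :: "'a measure"
  assumes space_eq_UNIV: "space \<mu> = UNIV"
    and balls_measurable: "r > 0 \<Longrightarrow> qball \<rho> x r \<in> sets \<mu>"
    and doubling: "\<exists>C::real. \<forall>x. \<forall>r>0.
          emeasure \<mu> (qball \<rho> x (2 * r)) \<le> ennreal C * emeasure \<mu> (qball \<rho> x r)"

text \<open>
  The topology of a quasi-metric. With these open sets every neighbourhood of a point contains
  a ball around it, but balls themselves need not be open. Hence the balls centred at a point form a
  basis of open neighbourhoods of it exactly when all balls are open.
\<close>

definition quasi_open :: "('a \<Rightarrow> 'a \<Rightarrow> real) \<Rightarrow> 'a set \<Rightarrow> bool" where
  "quasi_open \<rho> U \<longleftrightarrow> (\<forall>x\<in>U. \<exists>r>0. qball \<rho> x r \<subseteq> U)"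

definition quasi_borel_sets :: "('a \<Rightarrow> 'a \<Rightarrow> real) \<Rightarrow> 'a set set" where
  "quasi_borel_sets \<rho> = sigma_sets UNIV {U. quasi_open \<rho> U}"

text \<open>
  Borel regularity speaks about arbitrary subsets, so the outer measure induced by
  \<open>\<mu>\<close> is used there; it agrees with \<open>\<mu>\<close> on measurable sets.
\<close>

locale basic_assumptions =
  fixes \<rho> :: "'a \<Rightarrow> 'a \<Rightarrow> real" and \<mu> :: "'a measure"
  assumes balls_open: "r > 0 \<Longrightarrow> quasi_open \<rho> (qball \<rho> x r)"
    and open_measurable: "quasi_open \<rho> U \<Longrightarrow> U \<in> sets \<mu>"
    and borel_regular:
      "\<exists>E\<in>quasi_borel_sets \<rho>. A \<subseteq> E \<and> outer_measure_of \<mu> A = emeasure \<mu> E"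
    and ball_pos: "r > 0 \<Longrightarrow> 0 < emeasure \<mu> (qball \<rho> x r)"
    and ball_finite: "r > 0 \<Longrightarrow> emeasure \<mu> (qball \<rho> x r) < \<infinity>"
    and diam_infinite: "\<exists>x y. \<rho> x y > C"
    and points_null: "emeasure \<mu> {x} = 0"

definition monotone_geodesic :: "('a \<Rightarrow> 'a \<Rightarrow> real) \<Rightarrow> bool" where
  "monotone_geodesic \<rho> \<longleftrightarrow>
    (\<exists>K>0. \<forall>s>0. \<forall>x y. s \<le> \<rho> x y \<longrightarrow>
      (\<exists>(m::nat) z. z 0 = x \<and> z m = y \<and>
        (\<forall>i<m. \<rho> (z i) (z (Suc i)) \<le> K * s \<and> \<rho> (z (Suc i)) (z m) \<le> \<rho> (z i) (z m) - s)))"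


section \<open>The space-time product and parabolic cylinders\<close>

definition parabolic_dist :: "real \<Rightarrow> ('a \<Rightarrow> 'a \<Rightarrow> real) \<Rightarrow> 'a \<times> real \<Rightarrow> 'a \<times> real \<Rightarrow> real" where
  "parabolic_dist p \<rho> = (\<lambda>(x, t) (y, s). max (\<rho> x y) (\<bar>t - s\<bar> powr (1 / p)))"

definition spacetime_measure :: "'a measure \<Rightarrow> ('a \<times> real) measure" where
  "spacetime_measure \<mu> = \<mu> \<Otimes>\<^sub>M lebesgue"

definition cylinder ::
  "real \<Rightarrow> ('a \<Rightarrow> 'a \<Rightarrow> real) \<Rightarrow> 'a \<Rightarrow> real \<Rightarrow> real \<Rightarrow> ('a \<times> real) set" where
  "cylinder p \<rho> x t l = qball \<rho> x l \<times> {t - l powr p <..< t + l powr p}"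

definition cylinder_minus ::
  "real \<Rightarrow> ('a \<Rightarrow> 'a \<Rightarrow> real) \<Rightarrow> real \<Rightarrow> 'a \<Rightarrow> real \<Rightarrow> real \<Rightarrow> ('a \<times> real) set" where
  "cylinder_minus p \<rho> \<gamma> x t l = qball \<rho> x l \<times> {t - l powr p <..< t - \<gamma> * l powr p}"

definition cylinder_plus ::
  "real \<Rightarrow> ('a \<Rightarrow> 'a \<Rightarrow> real) \<Rightarrow> real \<Rightarrow> 'a \<Rightarrow> real \<Rightarrow> real \<Rightarrow> ('a \<times> real) set" where
  "cylinder_plus p \<rho> \<gamma> x t l = qball \<rho> x l \<times> {t + \<gamma> * l powr p <..< t + l powr p}"


section \<open>Weights\<close>

definition weight :: "real \<Rightarrow> ('a \<Rightarrow> 'a \<Rightarrow> real) \<Rightarrow> 'a measure \<Rightarrow> ('a \<times> real \<Rightarrow> real) \<Rightarrow> bool" where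
  "weight p \<rho> \<mu> \<omega> \<longleftrightarrow>
    \<omega> \<in> borel_measurable (spacetime_measure \<mu>) \<and>
    (AE z in spacetime_measure \<mu>. 0 < \<omega> z) \<and>
    (\<forall>x t. \<exists>r>0. set_integrable (spacetime_measure \<mu>) (cylinder p \<rho> x t r) \<omega>)"

text \<open>
  Averages of functions that are nonnegative almost everywhere, with values in \<open>[0, \<infinity>]\<close>: a weight
  need not be integrable over a large cylinder, and its negative power may fail to be integrable
  over a small one.
\<close>

definition average :: "'b measure \<Rightarrow> 'b set \<Rightarrow> ('b \<Rightarrow> real) \<Rightarrow> ennreal" where
  "average M E f = (\<integral>\<^sup>+z\<in>E. ennreal (f z) \<partial>M) / emeasure M E"

text \<open>Powers with a positive real exponent on \<open>[0, \<infinity>]\<close>.\<close>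

definition ennreal_power :: "ennreal \<Rightarrow> real \<Rightarrow> ennreal" where
  "ennreal_power u a = (if u = \<infinity> then \<infinity> else ennreal (enn2real u powr a))"

definition conj_exponent :: "real \<Rightarrow> real" where
  "conj_exponent q = q / (q - 1)"

lemma conj_exponent_iff:
  assumes "1 < q"
  shows "1 / q + 1 / q' = 1 \<longleftrightarrow> q' = conj_exponent q"
proof (cases "q' = 0")
  case True
  then show ?thesis using assms by (simp add: conj_exponent_def)
next
  case False
  then show ?thesis using assms by (auto simp: conj_exponent_def field_simps)
qed

definition A_plus ::
  "real \<Rightarrow> ('a \<Rightarrow> 'a \<Rightarrow> real) \<Rightarrow> 'a measure \<Rightarrow> real \<Rightarrow> real \<Rightarrow> ('a \<times> real \<Rightarrow> real) set" where
  "A_plus p \<rho> \<mu> q \<gamma> = {\<omega>. weight p \<rho> \<mu> \<omega> \<and>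
    (SUP (x, t, l) \<in> UNIV \<times> UNIV \<times> {0<..}.
        average (spacetime_measure \<mu>) (cylinder_minus p \<rho> \<gamma> x t l) \<omega> *
        ennreal_power
          (average (spacetime_measure \<mu>) (cylinder_plus p \<rho> \<gamma> x t l)
            (\<lambda>z. \<omega> z powr (1 - conj_exponent q)))
          (q - 1)) < \<infinity>}"

end

theory Submission
  imports Defs
begin

text \<open>
  Let \<open>Q(x, r, a)\<close> be the product of the ball \<open>B(x, r)\<close> and the time interval of length
  \<open>(1 - \<gamma>) r^p\<close> starting at \<open>a\<close>. The condition with lag \<open>\<gamma>\<close> bounds the average of \<open>\<omega>\<close> over
  \<open>Q(x, r, a)\<close> against the average of \<open>\<sigma> = \<omega>^(1 - q')\<close> over \<open>Q(x, r, a + (1 + \<gamma>) r^p)\<close>, and on any set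
  Hoelder's inequality bounds the latter against the average of \<open>\<omega>\<close> from below. Hence the average of
  \<open>\<omega>\<close> grows at most by a constant factor when one passes backwards in time from a slab to one that is
  nearby in space and about \<open>(1 + \<gamma>) r^p\<close> earlier. For any lag \<open>\<delta> > 0\<close> and a radius \<open>r = \<epsilon> l\<close> with
  small \<open>\<epsilon>\<close>, a bounded number of such steps leads from each small slab in the lower part to each
  small slab in the upper part of a cylinder of radius \<open>l\<close>, and boundedly many small slabs cover
  these parts. So one positive lag is as good as another, in both directions.
\<close>

section \<open>Positive densities and a reciprocal form of Hoelder's inequality\<close>

lemma sigma_finite_lebesgue: "sigma_finite_measure (lebesgue :: real measure)"
proof
  have "(\<Union>n. {- real n..real n}) = UNIV"
  proof (intro set_eqI iffI UNIV_I)
    fix x :: real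
    obtain n :: nat where "\<bar>x\<bar> \<le> real n" using real_arch_simple by blast
    then have "x \<in> {- real n..real n}" by auto
    then show "x \<in> (\<Union>n. {- real n..real n})" by blast
  qed
  then show "\<exists>A. countable A \<and> A \<subseteq> sets (lebesgue :: real measure) \<and> \<Union> A = space lebesgue \<and>
      (\<forall>a\<in>A. emeasure lebesgue a \<noteq> \<infinity>)"
    by (intro exI[of _ "range (\<lambda>n::nat. {- real n..real n})"]) auto
qed

text \<open>A function that is positive almost everywhere and has zero integral over
  \<open>E\<close> would force \<open>E\<close> to be a null set.\<close>

lemma emeasure_density_pos:
  fixes f :: "'b \<Rightarrow> real"
  assumes [measurable]: "f \<in> borel_measurable M" and pos: "AE z in M. 0 < f z"
    and [measurable]: "E \<in> sets M" and E: "emeasure M E \<noteq> 0"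
  shows "emeasure (density M (\<lambda>z. ennreal (f z))) E \<noteq> 0"
proof
  assume "emeasure (density M (\<lambda>z. ennreal (f z))) E = 0"
  then have "AE z in M. ennreal (f z) * indicator E z = 0"
    by (simp add: emeasure_density nn_integral_0_iff_AE)
  with pos have "AE z in M. z \<notin> E"
    by eventually_elim (auto simp: indicator_def split: if_splits)
  then show False using E AE_iff_null_sets[of E M] by (auto simp: null_sets_def)
qed

text \<open>After division of \<open>f\<close> by its mean \<open>W\<close>, Young's inequality
  bounds \<open>1\<close>, written as a product of powers of \<open>f / W\<close> and of
  \<open>(f / W) powr (1 - conj_exponent q)\<close>, by a weighted sum of these two functions.
  Integration over \<open>E\<close> then brings in the two means. The result bounds from below the
  very product that the weight condition bounds from above.\<close>

lemma Holder_reciprocal: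
  fixes f :: "'b \<Rightarrow> real"
  assumes f [measurable]: "f \<in> borel_measurable M" and pos: "AE z in M. 0 < f z" and q: "1 < q"
    and E [measurable]: "E \<in> sets M" and E0: "0 < measure M E"
    and F: "emeasure (density M (\<lambda>z. ennreal (f z))) E < \<infinity>"
    and G: "emeasure (density M (\<lambda>z. ennreal (f z powr (1 - conj_exponent q)))) E < \<infinity>"
    and W: "W = measure (density M (\<lambda>z. ennreal (f z))) E / measure M E" "0 < W"
    and S: "S = measure (density M (\<lambda>z. ennreal (f z powr (1 - conj_exponent q)))) E / measure M E"
  shows "1 \<le> W * S powr (q - 1)"
proof -
  define e where "e = 1 - conj_exponent q"
  have e: "e = - 1 / (q - 1)" using q by (simp add: e_def conj_exponent_def field_simps)
  define F where "F = (\<lambda>z. ennreal (f z))"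
  define G where "G = (\<lambda>z. ennreal (f z powr e))"
  have [measurable]: "F \<in> borel_measurable M" "G \<in> borel_measurable M"
    by (simp_all add: F_def G_def)
  have Efin: "emeasure M E \<noteq> \<infinity>" using E0 by (auto simp: measure_def)
  \<comment> \<open>This is \<open>W powr (- e)\<close>, which turns \<open>c * f z powr e\<close>
    into the power \<open>e\<close> of \<open>f z / W\<close>.\<close>
  define c where "c = W powr (1 / (q - 1))"
  have young: "1 \<le> (1 / q) * (f z / W) + (1 - 1 / q) * (c * f z powr e)" if "0 < f z" for z
  proof -
    let ?a = "f z / W"
    have b: "c * f z powr e = ?a powr e"
      using that W(2) q by (simp add: c_def e powr_divide powr_minus_divide)
    have "?a powr (1 / q) * (?a powr e) powr (1 - 1 / q) = ?a powr (1 / q + e * (1 - 1 / q))"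
      by (simp add: powr_powr powr_add)
    \<comment> \<open>The weights \<open>1 / q\<close> and \<open>1 - 1 / q\<close> are the ones for
      which the two powers of \<open>f z / W\<close> cancel.\<close>
    also have "1 / q + e * (1 - 1 / q) = 0" using q by (simp add: e field_simps)
    finally have "1 = ?a powr (1 / q) * (?a powr e) powr (1 - 1 / q)" using that W(2) by simp
    also have "\<dots> \<le> 1 / q * ?a + (1 - 1 / q) * ?a powr e"
      using that W(2) q by (intro Youngs_inequality_0) auto
    finally show ?thesis by (simp add: b)
  qed
  have c0: "0 \<le> c" by (simp add: c_def)
  define \<alpha> where "\<alpha> = 1 / (q * W)"
  define \<beta> where "\<beta> = (1 - 1 / q) * c"
  have \<alpha>0: "0 \<le> \<alpha>" and \<beta>0: "0 \<le> \<beta>" using q W(2) c0 by (auto simp: \<alpha>_def \<beta>_def)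
  have "emeasure M E = (\<integral>\<^sup>+z. indicator E z \<partial>M)" by simp
  also have "\<dots> \<le> (\<integral>\<^sup>+z. \<alpha> * (F z * indicator E z) + \<beta> * (G z * indicator E z) \<partial>M)"
  proof (intro nn_integral_mono_AE eventually_mono[OF pos])
    fix z assume elim: "0 < f z"
    have "1 \<le> ennreal (\<alpha> * f z + \<beta> * f z powr e)"
      using young[OF elim] by (simp add: \<alpha>_def \<beta>_def mult.assoc)
    also have "\<dots> = ennreal \<alpha> * F z + ennreal \<beta> * G z"
      using elim \<alpha>0 \<beta>0 by (simp add: F_def G_def ennreal_mult)
    finally show "indicator E z \<le> \<alpha> * (F z * indicator E z) + \<beta> * (G z * indicator E z)"
      by (auto split: split_indicator)
  qed
  also have "\<dots> = \<alpha> * emeasure (density M F) E + \<beta> * emeasure (density M G) E"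
    by (simp add: nn_integral_add nn_integral_cmult emeasure_density)
  finally have *: "emeasure M E \<le> \<alpha> * emeasure (density M F) E + \<beta> * emeasure (density M G) E" .
  have "ennreal (measure M E) \<le> ennreal (\<alpha> * measure (density M F) E + \<beta> * measure (density M G) E)"
    using * assms(6,7) Efin \<alpha>0 \<beta>0
    by (simp add: F_def G_def e_def emeasure_eq_ennreal_measure less_top ennreal_mult)
  then have "measure M E \<le> \<alpha> * measure (density M F) E + \<beta> * measure (density M G) E"
    using \<alpha>0 \<beta>0 by (subst (asm) ennreal_le_iff) auto
  also have "\<dots> = (\<alpha> * W + \<beta> * S) * measure M E"
    using E0 by (simp add: W(1) S F_def G_def e_def field_simps)
  finally have "1 \<le> \<alpha> * W + \<beta> * S" using E0 by simp
  \<comment> \<open>Since \<open>\<alpha> * W = 1 / q\<close>, moving this term to the left leaves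
    the factor \<open>1 - 1 / q\<close> on both sides.\<close>
  then have "(1 - 1 / q) * 1 \<le> (1 - 1 / q) * (c * S)"
    using W(2) by (simp add: \<alpha>_def \<beta>_def mult.assoc)
  moreover have "0 < 1 - 1 / q" using q by simp
  ultimately have "1 \<le> c * S" by (simp only: mult_le_cancel_left_pos)
  then have "1 powr (q - 1) \<le> (c * S) powr (q - 1)" using q by (intro powr_mono2) auto
  moreover have "0 \<le> S" by (simp add: S)
  ultimately show ?thesis using q W(2) c0 by (simp add: powr_mult c_def powr_powr)
qed

section \<open>Volume growth, finite covers and chains in the underlying space\<close>

locale doubling_space = homogeneous_type_space \<rho> \<mu> + basic_assumptions \<rho> \<mu>
  for \<rho> :: "'a \<Rightarrow> 'a \<Rightarrow> real" and \<mu> :: "'a measure"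
begin

abbreviation vol :: "'a \<Rightarrow> real \<Rightarrow> real" where
  "vol x r \<equiv> measure \<mu> (qball \<rho> x r)"

lemma quasi_triangleE:
  obtains K where "1 \<le> K" "\<And>x y z. \<rho> x y \<le> K * (\<rho> x z + \<rho> z y)"
  using quasi_triangle by blast

lemma qball_fmeasurable: "0 < r \<Longrightarrow> qball \<rho> x r \<in> fmeasurable \<mu>"
  using balls_measurable ball_finite by (auto intro: fmeasurableI)

lemma emeasure_qball: "0 < r \<Longrightarrow> emeasure \<mu> (qball \<rho> x r) = ennreal (vol x r)"
  using ball_finite[of r x] by (intro emeasure_eq_ennreal_measure) auto

lemma vol_pos: "0 < r \<Longrightarrow> 0 < vol x r"
  using ball_pos[of r x] by (simp add: emeasure_qball)

lemma vol_mono: "qball \<rho> x r \<subseteq> qball \<rho> y s \<Longrightarrow> 0 < r \<Longrightarrow> 0 < s \<Longrightarrow> vol x r \<le> vol y s"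
  using balls_measurable by (intro measure_mono_fmeasurable qball_fmeasurable) auto

lemma vol_doubling: obtains C where "1 \<le> C" "\<And>x r. 0 < r \<Longrightarrow> vol x (2 * r) \<le> C * vol x r"
proof -
  obtain C where C: "\<And>x r. 0 < r \<Longrightarrow>
      emeasure \<mu> (qball \<rho> x (2 * r)) \<le> ennreal C * emeasure \<mu> (qball \<rho> x r)"
    using doubling by blast
  have "vol x (2 * r) \<le> max 1 C * vol x r" if "0 < r" for x r
  proof -
    have "ennreal (vol x (2 * r)) \<le> ennreal C * ennreal (vol x r)"
      using C[OF that, of x] that by (simp add: emeasure_qball)
    also have "\<dots> \<le> ennreal (max 1 C) * ennreal (vol x r)"
      by (intro mult_right_mono ennreal_leI) auto
    also have "\<dots> = ennreal (max 1 C * vol x r)" by (simp add: ennreal_mult)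
    finally show ?thesis by (subst (asm) ennreal_le_iff) auto
  qed
  then show ?thesis by (intro that[of "max 1 C"]) auto
qed

text \<open>Doubling is iterated until \<open>2 ^ k\<close> exceeds \<open>B\<close>, so the
  constant is the same for all balls.\<close>

lemma vol_dilation:
  obtains D where "1 \<le> D" "\<And>x r. 0 < r \<Longrightarrow> vol x (B * r) \<le> D * vol x r"
proof -
  obtain C where C: "1 \<le> C" "\<And>x r. 0 < r \<Longrightarrow> vol x (2 * r) \<le> C * vol x r"
    using vol_doubling by blast
  obtain k where k: "B < 2 ^ k" using real_arch_pow[of 2 B] by auto
  have it: "vol x (2 ^ n * r) \<le> C ^ n * vol x r" if "0 < r" for x r n
  proof (induction n)
    case (Suc n)
    have "vol x (2 ^ Suc n * r) \<le> C * vol x (2 ^ n * r)"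
      using C(2)[of "2 ^ n * r" x] that by (simp add: mult.assoc)
    also have "\<dots> \<le> C * (C ^ n * vol x r)" using Suc C(1) by (intro mult_left_mono) auto
    finally show ?case by (simp add: mult.assoc)
  qed simp
  have "vol x (B * r) \<le> C ^ k * vol x r" if "0 < r" for x r
  proof (cases "0 < B")
    case True
    have "vol x (B * r) \<le> vol x (2 ^ k * r)"
      using k that True by (intro vol_mono) (auto simp: qball_def elim!: less_le_trans)
    with it[OF that, of x k] show ?thesis by simp
  next
    case False
    \<comment> \<open>Distances are nonnegative, so a ball of nonpositive radius is empty.\<close>
    then have "B * r \<le> 0" using that by (simp add: mult_nonpos_nonneg)
    then have "qball \<rho> x (B * r) = {}"
      using nonneg[of x] by (auto simp: qball_def not_less intro: order_trans)
    then show ?thesis using C(1) by simp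
  qed
  then show ?thesis using C(1) by (intro that[of "C ^ k"]) auto
qed

text \<open>The centres form a largest subset of the ball with mutual distances at least
  \<open>\<epsilon> * l\<close>; a point missed by the cover could be added to it. Its size is
  bounded by packing: smaller balls about the centres are disjoint, lie in one ball of radius
  \<open>2 * K * l\<close>, and each carries at least the fraction \<open>1 / D\<close> of that
  ball's measure.\<close>

lemma bounded_cover:
  assumes "0 < \<epsilon>" "\<epsilon> \<le> 1"
  obtains N :: nat where "\<And>x l. 0 < l \<Longrightarrow> \<exists>F. finite F \<and> card F \<le> N \<and> F \<subseteq> qball \<rho> x l \<and>
    qball \<rho> x l \<subseteq> (\<Union>y\<in>F. qball \<rho> y (\<epsilon> * l))"
proof -
  obtain K where K: "1 \<le> K" "\<And>x y z. \<rho> x y \<le> K * (\<rho> x z + \<rho> z y)" using quasi_triangleE by blast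
  \<comment> \<open>The factor is \<open>4 * K ^ 2 * l\<close>, a radius at which the ball about any
    centre contains the enclosing ball, divided by the packing radius
    \<open>\<epsilon> * l / (2 * K)\<close>.\<close>
  obtain D where D: "1 \<le> D" "\<And>x r. 0 < r \<Longrightarrow> vol x ((8 * K ^ 3 / \<epsilon>) * r) \<le> D * vol x r"
    using vol_dilation by blast
  define N where "N = nat \<lfloor>D\<rfloor>"
  have "\<exists>F. finite F \<and> card F \<le> N \<and> F \<subseteq> qball \<rho> x l \<and> qball \<rho> x l \<subseteq> (\<Union>y\<in>F. qball \<rho> y (\<epsilon> * l))"
    if l: "0 < l" for x l
  proof -
    define sep where "sep F \<longleftrightarrow> finite F \<and> F \<subseteq> qball \<rho> x l \<and>
      (\<forall>y\<in>F. \<forall>z\<in>F. y \<noteq> z \<longrightarrow> \<epsilon> * l \<le> \<rho> y z)" for F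
    \<comment> \<open>A common point of two balls of this radius puts their centres closer than
      \<open>K * (r + r) = \<epsilon> * l\<close>.\<close>
    define r where "r = \<epsilon> * l / (2 * K)"
    have r: "0 < r" using assms K(1) l by (simp add: r_def)
    have rl: "r \<le> l"
    proof -
      have "\<epsilon> * l \<le> 1 * l" using assms l by (intro mult_right_mono) auto
      also have "\<dots> \<le> 2 * K * l" using K(1) l by (intro mult_right_mono) auto
      finally show ?thesis using K(1) by (simp add: r_def field_simps)
    qed
    have card: "card F \<le> N" if "sep F" for F
    proof -
      have fin: "finite F" and sub: "F \<subseteq> qball \<rho> x l"
        and dist: "\<And>y z. y \<in> F \<Longrightarrow> z \<in> F \<Longrightarrow> y \<noteq> z \<Longrightarrow> \<epsilon> * l \<le> \<rho> y z"
        using that by (auto simp: sep_def)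
      have disj: "disjoint_family_on (\<lambda>y. qball \<rho> y r) F"
        unfolding disjoint_family_on_def
      proof (intro ballI impI, rule ccontr)
        fix y z assume yz: "y \<in> F" "z \<in> F" "y \<noteq> z" "qball \<rho> y r \<inter> qball \<rho> z r \<noteq> {}"
        then obtain w where w: "\<rho> y w < r" "\<rho> w z < r" by (auto simp: qball_def sym)
        have "\<rho> y z \<le> K * (\<rho> y w + \<rho> w z)" by (rule K)
        also have "\<dots> < K * (r + r)" using w K(1) by (intro mult_strict_left_mono) auto
        also have "\<dots> = \<epsilon> * l" using K(1) by (simp add: r_def)
        finally show False using dist[OF yz(1-3)] by simp
      qed
      have big: "vol x (2 * K * l) \<le> D * vol y r" if "y \<in> F" for y
      proof -
        have xy: "\<rho> x y < l" using sub that by (auto simp: qball_def)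
        have "qball \<rho> x (2 * K * l) \<subseteq> qball \<rho> y ((8 * K ^ 3 / \<epsilon>) * r)"
        proof
          fix z assume "z \<in> qball \<rho> x (2 * K * l)"
          then have z: "\<rho> x z < 2 * K * l" by (simp add: qball_def)
          have "\<rho> y z \<le> K * (\<rho> y x + \<rho> x z)" by (rule K)
          also have "\<dots> < K * (l + 2 * K * l)"
            using z xy K(1) by (intro mult_strict_left_mono) (auto simp: sym)
          also have "\<dots> \<le> K * (K * l + 2 * K * l)" using K(1) l by (intro mult_left_mono) auto
          also have "\<dots> \<le> 4 * K ^ 2 * l" using K(1) l by (simp add: power2_eq_square algebra_simps)
          also have "\<dots> = (8 * K ^ 3 / \<epsilon>) * r"
            using K(1) assms by (simp add: r_def field_simps power2_eq_square power3_eq_cube)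
          finally show "z \<in> qball \<rho> y ((8 * K ^ 3 / \<epsilon>) * r)" by (simp add: qball_def)
        qed
        then have "vol x (2 * K * l) \<le> vol y ((8 * K ^ 3 / \<epsilon>) * r)"
          using K(1) assms l r by (intro vol_mono) auto
        with D(2)[OF r, of y] show ?thesis by simp
      qed
      have inside: "(\<Union>y\<in>F. qball \<rho> y r) \<subseteq> qball \<rho> x (2 * K * l)"
      proof clarify
        fix y z assume "y \<in> F" "z \<in> qball \<rho> y r"
        then have yz: "\<rho> x y < l" "\<rho> y z < r" using sub by (auto simp: qball_def)
        have "\<rho> x z \<le> K * (\<rho> x y + \<rho> y z)" by (rule K)
        also have "\<dots> < K * (l + l)"
          using yz rl K(1) by (intro mult_strict_left_mono) auto
        finally show "z \<in> qball \<rho> x (2 * K * l)" by (simp add: qball_def)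
      qed
      have "real (card F) * vol x (2 * K * l) = (\<Sum>y\<in>F. vol x (2 * K * l))" by simp
      also have "\<dots> \<le> (\<Sum>y\<in>F. D * vol y r)" by (intro sum_mono big)
      also have "\<dots> = D * (\<Sum>y\<in>F. vol y r)" by (simp add: sum_distrib_left)
      also have "(\<Sum>y\<in>F. vol y r) = measure \<mu> (\<Union>y\<in>F. qball \<rho> y r)"
        using fin disj r balls_measurable ball_finite
        by (intro measure_finite_Union[symmetric]) (auto simp: less_top)
      also have "D * \<dots> \<le> D * vol x (2 * K * l)"
        using inside D(1) fin r l K(1) balls_measurable
        by (intro mult_left_mono measure_mono_fmeasurable qball_fmeasurable) auto
      finally have "real (card F) \<le> D" using vol_pos[of "2 * K * l" x] K(1) l by simp
      then show ?thesis by (simp add: N_def le_nat_floor)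
    qed
    have "sep {}" by (simp add: sep_def)
    \<comment> \<open>The packing bound \<open>N\<close> on the sizes of separated sets makes a
      largest one exist.\<close>
    then obtain F where F: "sep F" "\<And>G. sep G \<Longrightarrow> card G \<le> card F"
      using ex_has_greatest_nat[of sep "{}" card "Suc N"] card by (auto simp: less_Suc_eq_le)
    have "qball \<rho> x l \<subseteq> (\<Union>y\<in>F. qball \<rho> y (\<epsilon> * l))"
    proof (rule ccontr)
      assume "\<not> qball \<rho> x l \<subseteq> (\<Union>y\<in>F. qball \<rho> y (\<epsilon> * l))"
      then obtain z where z: "z \<in> qball \<rho> x l" "z \<notin> (\<Union>y\<in>F. qball \<rho> y (\<epsilon> * l))" by blast
      have far: "\<epsilon> * l \<le> \<rho> y z" if "y \<in> F" for y
        using z(2) that by (auto simp: qball_def not_less)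
      have "z \<notin> F" using far[of z] eq_0_iff[of z z] assms l by (auto simp: mult_le_0_iff)
      moreover have "sep (insert z F)" using F(1) z(1) far by (auto simp: sep_def sym)
      ultimately show False using F(2)[of "insert z F"] F(1) by (simp add: sep_def)
    qed
    then show ?thesis using F(1) card[OF F(1)] by (auto simp: sep_def)
  qed
  then show ?thesis by (rule that)
qed

text \<open>Each geodesic step lowers the distance to \<open>y\<close> by at least \<open>s\<close>,
  so there are at most \<open>\<rho> x y / s\<close> of them. Afterwards the chain rests at
  \<open>y\<close>; its number of steps can therefore be fitted to a prescribed amount of
  time.\<close>

lemma geodesic_chain:
  assumes "monotone_geodesic \<rho>"
  obtains L where "1 \<le> L" "\<And>s x y. 0 < s \<Longrightarrow> \<exists>z. z 0 = x \<and> (\<forall>i. \<rho> (z i) (z (Suc i)) \<le> L * s) \<and>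
    (\<forall>i::nat. \<rho> x y / s + 1 \<le> i \<longrightarrow> z i = y)"
proof -
  obtain K where K0: "0 < K" and K: "\<forall>s>0. \<forall>x y. s \<le> \<rho> x y \<longrightarrow>
      (\<exists>(m::nat) z. z 0 = x \<and> z m = y \<and>
        (\<forall>i<m. \<rho> (z i) (z (Suc i)) \<le> K * s \<and> \<rho> (z (Suc i)) (z m) \<le> \<rho> (z i) (z m) - s))"
    using assms unfolding monotone_geodesic_def by (elim exE conjE) (rule that)
  have "\<exists>z. z 0 = x \<and> (\<forall>i. \<rho> (z i) (z (Suc i)) \<le> max 1 K * s) \<and>
    (\<forall>i::nat. \<rho> x y / s + 1 \<le> i \<longrightarrow> z i = y)" if s: "0 < s" for s x y
  proof (cases "s \<le> \<rho> x y")
    case True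
    with K s have "\<exists>(m::nat) z. z 0 = x \<and> z m = y \<and>
        (\<forall>i<m. \<rho> (z i) (z (Suc i)) \<le> K * s \<and> \<rho> (z (Suc i)) (z m) \<le> \<rho> (z i) (z m) - s)"
      by simp
    then obtain m z where z: "z 0 = x" "z m = y" and
      step: "\<And>i. i < m \<Longrightarrow> \<rho> (z i) (z (Suc i)) \<le> K * s"
      and dec: "\<And>i. i < m \<Longrightarrow> \<rho> (z (Suc i)) (z m) \<le> \<rho> (z i) (z m) - s"
      by blast
    have "k \<le> m \<Longrightarrow> \<rho> (z k) y \<le> \<rho> x y - k * s" for k
    proof (induction k)
      case (Suc k)
      then show ?case using dec[of k] z by (simp add: algebra_simps)
    qed (simp add: z)
    from this[of m] have "m * s \<le> \<rho> x y" using nonneg[of "z m" y] by simp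
    then have m: "m \<le> \<rho> x y / s" using s by (simp add: field_simps)
    have "\<rho> (z (min i m)) (z (min (Suc i) m)) \<le> max 1 K * s" for i
    proof (cases "i < m")
      case True
      have "K * s \<le> max 1 K * s" using s by (intro mult_right_mono) auto
      then show ?thesis using step[OF True] True by (simp add: min_def)
    next
      case False
      then show ?thesis using eq_0_iff[of y y] s z by (simp add: min_def)
    qed
    then show ?thesis using m z by (intro exI[of _ "\<lambda>i. z (min i m)"]) (auto simp: min_def)
  next
    case False
    \<comment> \<open>Points closer than \<open>s\<close> are joined by a single jump, which
      accounts for the \<open>+ 1\<close> in the step count and for the \<open>1\<close> in
      \<open>max 1 K\<close>.\<close>
    have "s \<le> max 1 K * s" using s by (simp add: max_def)
    moreover have "\<not> \<rho> x y / s + 1 \<le> 0" using nonneg[of x y] s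
      by (simp add: not_le add_nonneg_pos)
    moreover have "\<rho> x y \<le> max 1 K * s" using False calculation(1) by simp
    ultimately show ?thesis using False s eq_0_iff[of y y]
      by (intro exI[of _ "\<lambda>i. if i = 0 then x else y"]) auto
  qed
  then show ?thesis by (intro that[of "max 1 K"]) auto
qed

end

section \<open>Slabs and their averages for a fixed weight\<close>

locale one_sided_weight = doubling_space \<rho> \<mu>
  for \<rho> :: "'a \<Rightarrow> 'a \<Rightarrow> real" and \<mu> :: "'a measure" +
  fixes p q \<gamma> A :: real and \<omega> :: "'a \<times> real \<Rightarrow> real"
  assumes geodesic: "monotone_geodesic \<rho>"
    and p: "1 < p" and q: "1 < q" and \<gamma>: "0 \<le> \<gamma>" "\<gamma> < 1" and A: "1 \<le> A"
    and weight: "weight p \<rho> \<mu> \<omega>"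
    and A_plus_bound: "0 < l \<Longrightarrow>
        average (spacetime_measure \<mu>) (cylinder_minus p \<rho> \<gamma> x t l) \<omega> *
        ennreal_power
          (average (spacetime_measure \<mu>) (cylinder_plus p \<rho> \<gamma> x t l)
            (\<lambda>z. \<omega> z powr (1 - conj_exponent q)))
          (q - 1) \<le> ennreal A"
begin

abbreviation ST :: "('a \<times> real) measure" where
  "ST \<equiv> spacetime_measure \<mu>"

definition \<sigma> :: "'a \<times> real \<Rightarrow> real" where
  "\<sigma> z = \<omega> z powr (1 - conj_exponent q)"

definition W :: "('a \<times> real) measure" where
  "W = density ST (\<lambda>z. ennreal (\<omega> z))"

definition S :: "('a \<times> real) measure" where
  "S = density ST (\<lambda>z. ennreal (\<sigma> z))"

definition box :: "'a \<Rightarrow> real \<Rightarrow> real \<Rightarrow> real \<Rightarrow> ('a \<times> real) set" where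
  "box x r a b = qball \<rho> x r \<times> {a<..<b}"

text \<open>These are the sets Q(x, r, a). Lower and upper parts of cylinders both have this form,
  and passing from one to the other is a translation of the initial time.\<close>

definition slab :: "'a \<Rightarrow> real \<Rightarrow> real \<Rightarrow> ('a \<times> real) set" where
  "slab x r a = box x r a (a + (1 - \<gamma>) * r powr p)"

definition slab_vol :: "'a \<Rightarrow> real \<Rightarrow> real" where
  "slab_vol x r = vol x r * ((1 - \<gamma>) * r powr p)"

text \<open>The real-valued \<open>measure\<close> is \<open>0\<close> on sets of infinite measure,
  so this is the true average only because of \<open>slab_weights_finite\<close>; the same holds for
  \<open>avgS\<close>.\<close>

definition avgW :: "'a \<Rightarrow> real \<Rightarrow> real \<Rightarrow> real" where
  "avgW x r a = measure W (slab x r a) / slab_vol x r"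

definition avgS :: "'a \<Rightarrow> real \<Rightarrow> real \<Rightarrow> real" where
  "avgS x r a = measure S (slab x r a) / slab_vol x r"

lemma sets_W [simp]: "sets W = sets ST" and sets_S [simp]: "sets S = sets ST"
  by (simp_all add: W_def S_def)

lemma \<omega>_measurable [measurable]: "\<omega> \<in> borel_measurable ST"
  and \<omega>_pos: "AE z in ST. 0 < \<omega> z"
  using weight by (auto simp: weight_def)

lemma \<sigma>_measurable [measurable]: "\<sigma> \<in> borel_measurable ST"
  unfolding \<sigma>_def by measurable

lemma \<sigma>_pos: "AE z in ST. 0 < \<sigma> z"
  using \<omega>_pos by eventually_elim (simp add: \<sigma>_def)

lemma box_sets [simp]: "0 < r \<Longrightarrow> box x r a b \<in> sets ST"
  by (simp add: box_def spacetime_measure_def balls_measurable)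

lemma slab_sets [simp]: "0 < r \<Longrightarrow> slab x r a \<in> sets ST"
  by (simp add: slab_def)

lemma emeasure_box:
  assumes "0 < r" "a \<le> b"
  shows "emeasure ST (box x r a b) = ennreal (vol x r * (b - a))"
  using assms unfolding box_def spacetime_measure_def
  by (subst sigma_finite_measure.emeasure_pair_measure_Times[OF sigma_finite_lebesgue])
     (auto simp: balls_measurable emeasure_qball ennreal_mult)

lemma slab_length_pos: "0 < r \<Longrightarrow> 0 < (1 - \<gamma>) * r powr p"
  using \<gamma> by simp

lemma slab_vol_pos: "0 < r \<Longrightarrow> 0 < slab_vol x r"
  using slab_length_pos vol_pos by (simp add: slab_vol_def)

lemma emeasure_slab: "0 < r \<Longrightarrow> emeasure ST (slab x r a) = ennreal (slab_vol x r)"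
  using emeasure_box[of r a "a + (1 - \<gamma>) * r powr p" x] slab_length_pos[of r]
  by (simp add: slab_def slab_vol_def)

lemma average_\<omega>: "E \<in> sets ST \<Longrightarrow> average ST E \<omega> = emeasure W E / emeasure ST E"
  and average_\<sigma>: "E \<in> sets ST \<Longrightarrow>
    average ST E (\<lambda>z. \<omega> z powr (1 - conj_exponent q)) = emeasure S E / emeasure ST E"
  by (simp_all add: average_def W_def S_def emeasure_density \<sigma>_def[symmetric])

text \<open>This is the weight condition for the cylinder with centre time
  \<open>a + r powr p\<close>, whose lower part starts at time \<open>a\<close>.\<close>

lemma slab_bound_ennreal:
  assumes "0 < r"
  shows "emeasure W (slab x r a) / ennreal (slab_vol x r) *
    ennreal_power (emeasure S (slab x r (a + (1 + \<gamma>) * r powr p)) / ennreal (slab_vol x r)) (q - 1)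
      \<le> ennreal A"
proof -
  have "cylinder_minus p \<rho> \<gamma> x (a + r powr p) r = slab x r a"
    by (simp add: cylinder_minus_def slab_def box_def algebra_simps)
  moreover have "cylinder_plus p \<rho> \<gamma> x (a + r powr p) r = slab x r (a + (1 + \<gamma>) * r powr p)"
    by (simp add: cylinder_plus_def slab_def box_def algebra_simps)
  ultimately show ?thesis
    using A_plus_bound[OF assms, of x "a + r powr p"] assms
    by (simp add: average_\<omega> average_\<sigma> emeasure_slab)
qed

lemma slab_weights_nonzero:
  assumes "0 < r"
  shows "emeasure W (slab x r a) \<noteq> 0" "emeasure S (slab x r a) \<noteq> 0"
  using emeasure_density_pos[OF \<omega>_measurable \<omega>_pos slab_sets[OF assms]]
    emeasure_density_pos[OF \<sigma>_measurable \<sigma>_pos slab_sets[OF assms]]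
    slab_vol_pos[OF assms, of x] by (simp_all add: emeasure_slab assms W_def S_def)

text \<open>Local integrability says nothing about large slabs or about \<open>\<sigma>\<close>. But
  every slab is the lower part of one cylinder and the upper part of another, and in a finite
  product of two nonzero factors neither can be infinite.\<close>

lemma slab_weights_finite:
  assumes "0 < r"
  shows "emeasure W (slab x r a) < \<infinity>" "emeasure S (slab x r a) < \<infinity>"
proof -
  have v: "0 < slab_vol x r" using assms by (rule slab_vol_pos)
  have *: "u < \<infinity>" "w < \<infinity>"
    if "u / ennreal (slab_vol x r) * ennreal_power (w / ennreal (slab_vol x r)) (q - 1) \<le> ennreal A"
      "u \<noteq> 0" "w \<noteq> 0" for u w
  proof -
    let ?v = "ennreal (slab_vol x r)"
    have u0: "u / ?v \<noteq> 0" and w0: "w / ?v \<noteq> 0"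
      using that v by auto
    have fin: "u / ?v * ennreal_power (w / ?v) (q - 1) \<noteq> top"
      using that(1) by (auto simp: top_unique)
    have "ennreal_power (w / ?v) (q - 1) \<noteq> 0"
      using w0 by (cases "w / ?v") (auto simp: ennreal_power_def)
    then have "u / ?v \<noteq> top" using fin by (auto simp: ennreal_top_mult)
    then show "u < \<infinity>" using v by (cases u) (auto simp: ennreal_top_divide)
    have "ennreal_power (w / ?v) (q - 1) \<noteq> top" using fin u0 by (auto simp: ennreal_mult_top)
    then have "w / ?v \<noteq> top" by (auto simp: ennreal_power_def)
    then show "w < \<infinity>" using v by (cases w) (auto simp: ennreal_top_divide)
  qed
  show "emeasure W (slab x r a) < \<infinity>"
    using slab_weights_nonzero[OF assms] by (intro *(1)[OF slab_bound_ennreal[OF assms]])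
  show "emeasure S (slab x r a) < \<infinity>"
    \<comment> \<open>The slab at \<open>a\<close> is the upper one in the pair whose lower slab
      starts \<open>(1 + \<gamma>) * r powr p\<close> earlier.\<close>
    using slab_weights_nonzero[OF assms] *(2)[OF slab_bound_ennreal[OF assms, of x "a - (1 + \<gamma>) * r powr p"]]
    by simp
qed

lemma emeasure_slab_weights:
  assumes "0 < r"
  shows "emeasure W (slab x r a) = ennreal (avgW x r a * slab_vol x r)"
    "emeasure S (slab x r a) = ennreal (avgS x r a * slab_vol x r)"
  using slab_weights_finite[OF assms, of x a] slab_vol_pos[OF assms, of x]
  by (simp_all add: avgW_def avgS_def emeasure_eq_ennreal_measure)

lemma avg_pos:
  assumes "0 < r"
  shows "0 < avgW x r a" "0 < avgS x r a"
  using slab_weights_nonzero[OF assms, of x a] slab_vol_pos[OF assms, of x]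
  by (auto simp: emeasure_slab_weights[OF assms] not_le[symmetric] mult_nonpos_nonneg ennreal_neg)

section \<open>Propagation of averages through space and time\<close>

lemma slab_bound:
  assumes "0 < r"
  shows "avgW x r a * avgS x r (a + (1 + \<gamma>) * r powr p) powr (q - 1) \<le> A"
proof -
  have "ennreal (m * slab_vol x r) / ennreal (slab_vol x r) = ennreal m" if "0 \<le> m" for m
    using that slab_vol_pos[OF assms, of x] by (simp add: divide_ennreal)
  note cancel = this[OF less_imp_le[OF avg_pos(1)[OF assms]]] this[OF less_imp_le[OF avg_pos(2)[OF assms]]]
  have "ennreal (avgW x r a * avgS x r (a + (1 + \<gamma>) * r powr p) powr (q - 1)) \<le> ennreal A"
    using slab_bound_ennreal[OF assms, of x a] avg_pos[OF assms]
    unfolding emeasure_slab_weights[OF assms] cancel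
    by (simp add: ennreal_power_def less_imp_le flip: ennreal_mult)
  then show ?thesis using A by (subst (asm) ennreal_le_iff) auto
qed

text \<open>Hoelder's inequality is applied on the intersection \<open>E\<close> of the target slab with the slab of \<open>\<sigma>\<close>
  paired with the source slab; \<open>E\<close> has size comparable to both.\<close>

lemma avgW_step:
  obtains c C where "0 < c" "1 \<le> C"
    "\<And>x y r a b. 0 < r \<Longrightarrow> \<rho> x y \<le> c * r \<Longrightarrow>
      \<bar>b - a - (1 + \<gamma>) * r powr p\<bar> \<le> (1 - \<gamma>) * r powr p / 2 \<Longrightarrow> avgW x r a \<le> C * avgW y r b"
proof -
  obtain K where K: "1 \<le> K" "\<And>x y z. \<rho> x y \<le> K * (\<rho> x z + \<rho> z y)" using quasi_triangleE by blast
  obtain D where D: "1 \<le> D" "\<And>x r. 0 < r \<Longrightarrow> vol x ((4 * K\<^sup>2) * r) \<le> D * vol x r"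
    using vol_dilation by blast
  \<comment> \<open>With this \<open>c\<close>, \<open>K * (c * r + c * r) = r\<close>, so the ball
    of radius \<open>c * r\<close> about \<open>x\<close> lies in the ball of radius
    \<open>r\<close> about \<open>y\<close>.\<close>
  define c where "c = 1 / (2 * K)"
  have c: "0 < c" "c \<le> 1" using K(1) by (auto simp: c_def)
  \<comment> \<open>This bounds the ratio of either slab to their common part: \<open>D\<close>
    comes from the balls, and \<open>2\<close> from time intervals that overlap in at least half
    their length.\<close>
  define k where "k = 2 * D"
  have k: "1 \<le> k" using D(1) by (simp add: k_def)
  have "avgW x r a \<le> A * k powr q * avgW y r b"
    if r: "0 < r" and xy: "\<rho> x y \<le> c * r"
      and ab: "\<bar>b - a - (1 + \<gamma>) * r powr p\<bar> \<le> (1 - \<gamma>) * r powr p / 2" for x y r a b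
  proof -
    define h where "h = (1 - \<gamma>) * r powr p"
    define a' where "a' = a + (1 + \<gamma>) * r powr p"
    define len where "len = min (a' + h) (b + h) - max a' b"
    define E where "E = box x (c * r) (max a' b) (min (a' + h) (b + h))"
    have h: "0 < h" using slab_length_pos[OF r] by (simp add: h_def)
    have "\<bar>b - a'\<bar> \<le> h / 2" using ab by (simp add: h_def a'_def diff_diff_eq)
    then have len: "h / 2 \<le> len" by (auto simp: len_def min_def max_def abs_if split: if_splits)
    have cr: "0 < c * r" "c * r \<le> r" using c r by auto
    have E_sets: "E \<in> sets ST" using cr by (simp add: E_def)
    define e where "e = vol x (c * r) * len"
    have e: "emeasure ST E = ennreal e"
      unfolding E_def e_def len_def
    proof (intro emeasure_box cr)
      show "max a' b \<le> min (a' + h) (b + h)" using len h unfolding len_def by linarith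
    qed
    have e0: "0 < e" using vol_pos[OF cr(1)] len h by (simp add: e_def)
    have E1: "E \<subseteq> slab x r a'"
      using cr by (auto simp: E_def slab_def box_def qball_def h_def)
    have E2: "E \<subseteq> slab y r b"
    proof -
      have "\<rho> y z < r" if "\<rho> x z < c * r" for z
      proof -
        have "\<rho> y z \<le> K * (\<rho> y x + \<rho> x z)" by (rule K)
        also have "\<dots> < K * (c * r + c * r)"
          using that xy K(1) by (intro mult_strict_left_mono) (auto simp: sym)
        also have "\<dots> = r" using K(1) by (simp add: c_def)
        finally show ?thesis .
      qed
      then show ?thesis by (auto simp: E_def slab_def box_def qball_def h_def)
    qed
    have K2: "vol x (2 * K * r) \<le> D * vol x (c * r)"
    proof -
      have "(4 * K\<^sup>2) * (c * r) = 2 * K * r" using K(1) by (simp add: c_def power2_eq_square)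
      with D(2)[OF cr(1), of x] show ?thesis by simp
    qed
    have big: "slab_vol w r \<le> k * e" if "\<rho> x w \<le> c * r" for w
    proof -
      have "qball \<rho> w r \<subseteq> qball \<rho> x (2 * K * r)"
      proof
        fix z assume "z \<in> qball \<rho> w r"
        then have "\<rho> w z < r" by (simp add: qball_def)
        have "\<rho> x z \<le> K * (\<rho> x w + \<rho> w z)" by (rule K)
        also have "\<dots> < K * (r + r)"
          using \<open>\<rho> w z < r\<close> that cr K(1) by (intro mult_strict_left_mono) auto
        finally show "z \<in> qball \<rho> x (2 * K * r)" by (simp add: qball_def)
      qed
      then have "vol w r \<le> vol x (2 * K * r)" using r K(1) by (intro vol_mono) auto
      with K2 have "vol w r \<le> D * vol x (c * r)" by simp
      then have "vol w r * h \<le> (D * vol x (c * r)) * (2 * len)"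
        using h len D(1) by (intro mult_mono) auto
      then show ?thesis by (simp add: slab_vol_def k_def e_def h_def algebra_simps)
    qed
    have fW: "emeasure W E < \<infinity>" and fS: "emeasure S E < \<infinity>"
      using emeasure_mono[OF E2, of W] slab_weights_finite(1)[OF r, of y b] r
        emeasure_mono[OF E1, of S] slab_weights_finite(2)[OF r, of x a']
      by (auto intro: le_less_trans)
    have mW: "measure W E \<le> measure W (slab y r b)" and mS: "measure S E \<le> measure S (slab x r a')"
      using E1 E2 E_sets r slab_weights_finite[OF r]
      by (auto intro!: measure_mono_fmeasurable fmeasurableI)
    have "emeasure W E \<noteq> 0"
      unfolding W_def using e0 e E_sets by (intro emeasure_density_pos \<omega>_measurable \<omega>_pos) auto
    then have W0: "0 < measure W E" using fW
      by (simp add: measure_def enn2real_positive_iff zero_less_iff_neq_zero)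
    have mE: "measure ST E = e" using e e0 by (simp add: measure_def)
    have "1 \<le> (measure W E / e) * (measure S E / e) powr (q - 1)"
      using Holder_reciprocal[OF \<omega>_measurable \<omega>_pos q E_sets, OF _ _ _ refl _ refl] fW fS W0 e0 mE
      by (simp add: W_def S_def \<sigma>_def)
    also have "\<dots> \<le> (k * avgW y r b) * (k * avgS x r a') powr (q - 1)"
    proof (intro mult_mono powr_mono2)
      have cmp: "m / e \<le> k * (n / v)" if "m \<le> n" "v \<le> k * e" "0 < v" "0 \<le> m" for m n v :: real
      proof -
        have "m * v \<le> n * (k * e)" using that by (intro mult_mono) auto
        then show ?thesis using that e0 by (simp add: field_simps)
      qed
      show "measure W E / e \<le> k * avgW y r b"
        unfolding avgW_def using mW big[OF xy] slab_vol_pos[OF r] by (intro cmp) auto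
      show "measure S E / e \<le> k * avgS x r a'"
        unfolding avgS_def using mS big[of x] cr eq_0_iff[of x x] slab_vol_pos[OF r]
        by (intro cmp) auto
    qed (use q e0 k avg_pos[OF r] in \<open>auto intro: less_imp_le\<close>)
    also have "\<dots> = k powr q * (avgW y r b * avgS x r a' powr (q - 1))"
      using k avg_pos(2)[OF r, of x a'] by (simp add: powr_mult powr_diff)
    finally have 1: "1 \<le> k powr q * (avgW y r b * avgS x r a' powr (q - 1))" .
    \<comment> \<open>The Hoelder bound is multiplied by the source average, whose product with the
      paired average of \<open>\<sigma>\<close> is at most \<open>A\<close>.\<close>
    have "avgW x r a * 1 \<le> avgW x r a * (k powr q * (avgW y r b * avgS x r a' powr (q - 1)))"
      using 1 avg_pos(1)[OF r, of x a] by (intro mult_left_mono) auto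
    also have "\<dots> = (avgW x r a * avgS x r a' powr (q - 1)) * (k powr q * avgW y r b)" by simp
    also have "\<dots> \<le> A * (k powr q * avgW y r b)"
      using slab_bound[OF r, of x a] avg_pos(1)[OF r, of y b]
      by (intro mult_right_mono) (auto simp: a'_def)
    finally show ?thesis by (simp add: mult.assoc)
  qed
  moreover have "1 \<le> A * k powr q"
  proof -
    have "1 \<le> k powr q" using k q by (intro ge_one_powr_ge_zero) auto
    then have "1 * 1 \<le> A * k powr q" using A by (intro mult_mono) auto
    then show ?thesis by simp
  qed
  ultimately show ?thesis using c by (intro that[of c "A * k powr q"]) auto
qed

text \<open>
  A chain of about \<open>1 / \<epsilon>\<close> steps of size \<open>\<epsilon> * l\<close> reaches the required point of space, at a cost of
  about \<open>(\<epsilon> * l) powr p / \<epsilon>\<close> in time. This is below the available gap \<open>2 * \<delta> * l powr p\<close> for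
  small \<open>\<epsilon>\<close> because \<open>1 < p\<close>; the time that is left is filled with further steps.
\<close>

lemma avg_far:
  assumes \<delta>: "0 < \<delta>"
  obtains \<epsilon> C where "0 < \<epsilon>" "\<epsilon> \<le> 1" "1 \<le> C"
    "\<And>x y z l a b. 0 < l \<Longrightarrow> x \<in> qball \<rho> z l \<Longrightarrow> y \<in> qball \<rho> z l \<Longrightarrow>
      2 * \<delta> * l powr p \<le> b - a \<Longrightarrow> b - a \<le> 2 * l powr p \<Longrightarrow>
      avgW x (\<epsilon> * l) a * avgS y (\<epsilon> * l) b powr (q - 1) \<le> C"
proof -
  obtain K where K: "1 \<le> K" "\<And>x y z. \<rho> x y \<le> K * (\<rho> x z + \<rho> z y)" using quasi_triangleE by blast
  obtain c C\<^sub>0 where c: "0 < c" and C0: "1 \<le> C\<^sub>0" and step: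
    "\<And>x y r a b. 0 < r \<Longrightarrow> \<rho> x y \<le> c * r \<Longrightarrow>
      \<bar>b - a - (1 + \<gamma>) * r powr p\<bar> \<le> (1 - \<gamma>) * r powr p / 2 \<Longrightarrow> avgW x r a \<le> C\<^sub>0 * avgW y r b"
    using avgW_step by blast
  obtain L where L: "1 \<le> L" and chain:
    "\<And>s x y. 0 < s \<Longrightarrow> \<exists>z. z 0 = x \<and> (\<forall>i. \<rho> (z i) (z (Suc i)) \<le> L * s) \<and>
      (\<forall>i::nat. \<rho> x y / s + 1 \<le> i \<longrightarrow> z i = y)"
    using geodesic_chain[OF geodesic] by blast
  \<comment> \<open>After division by \<open>\<epsilon>\<close> the summands provide for the steps
    needed to cross the ball, for a step count so large that stretching the time step stays within
    tolerance, and for rounding.\<close>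
  define N where "N = 2 * K * L / c + 2 * (1 + \<gamma>) / (1 - \<gamma>) + 3"
  have N_parts: "0 < 2 * K * L / c" "0 < 2 * (1 + \<gamma>) / (1 - \<gamma>)"
    using K L c \<gamma> by auto
  \<comment> \<open>The choice gives \<open>\<epsilon> powr p = \<eta> * \<epsilon>\<close>, so
    \<open>(1 + N) / \<epsilon>\<close> steps of duration
    \<open>(1 + \<gamma>) * (\<epsilon> * l) powr p\<close> take at most the time
    \<open>2 * \<delta> * l powr p\<close>.\<close>
  define \<eta> where "\<eta> = min 1 (2 * \<delta> / ((1 + \<gamma>) * (1 + N)))"
  define \<epsilon> where "\<epsilon> = \<eta> powr (1 / (p - 1))"
  have N: "3 \<le> N" using N_parts unfolding N_def by linarith
  have N_denom: "0 < (1 + \<gamma>) * (1 + N)" using N \<gamma> by simp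
  have \<eta>: "0 < \<eta>" "\<eta> \<le> 1" using \<delta> N_denom by (simp_all add: \<eta>_def)
  have \<epsilon>: "0 < \<epsilon>" "\<epsilon> \<le> 1" using \<eta> p by (auto simp: \<epsilon>_def powr_le1)
  have \<epsilon>p: "\<epsilon> powr p = \<eta> * \<epsilon>"
  proof -
    have "\<epsilon> powr (p - 1) = \<eta>" using \<eta> p by (simp add: \<epsilon>_def powr_powr)
    then show ?thesis using powr_add[of \<epsilon> "p - 1" 1] \<epsilon> by simp
  qed
  \<comment> \<open>The gap \<open>b - a \<le> 2 * l powr p\<close> leaves room for at most this
    many steps, whatever the points and the radius \<open>l\<close>.\<close>
  define n where "n = nat \<lceil>2 / ((1 + \<gamma>) * \<epsilon> powr p)\<rceil>"
  have "avgW x (\<epsilon> * l) a * avgS y (\<epsilon> * l) b powr (q - 1) \<le> C\<^sub>0 ^ n * A"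
    if l: "0 < l" and x: "x \<in> qball \<rho> z l" and y: "y \<in> qball \<rho> z l"
      and T1: "2 * \<delta> * l powr p \<le> b - a" and T2: "b - a \<le> 2 * l powr p" for x y z l a b
  proof -
    define r where "r = \<epsilon> * l"
    have r: "0 < r" using \<epsilon> l by (simp add: r_def)
    have rp: "r powr p = \<epsilon> powr p * l powr p" using \<epsilon> l by (simp add: r_def powr_mult)
    define d where "d = (1 + \<gamma>) * r powr p"
    have d: "0 < d" using \<gamma> r by (simp add: d_def add_nonneg_pos)
    \<comment> \<open>One unit \<open>d\<close> of time is held back: the final passage from the
      average of \<open>\<omega>\<close> at \<open>y\<close> to that of \<open>\<sigma>\<close> uses
      it.\<close>
    define u where "u = (b - a) / d - 1"
    have u_ge: "N / \<epsilon> \<le> u"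
    proof -
      have "(1 + \<gamma>) * (1 + N) * \<eta> \<le> 2 * \<delta>"
      proof -
        have "\<eta> \<le> 2 * \<delta> / ((1 + \<gamma>) * (1 + N))" by (simp add: \<eta>_def)
        then show ?thesis using N_denom by (simp only: pos_le_divide_eq mult.commute)
      qed
      then have "(1 + \<gamma>) * (1 + N) * \<eta> * l powr p \<le> 2 * \<delta> * l powr p"
        by (intro mult_right_mono) auto
      also have "\<dots> \<le> b - a" by (rule T1)
      also have "(1 + \<gamma>) * (1 + N) * \<eta> * l powr p = (1 + N) / \<epsilon> * d"
        using \<epsilon> by (simp add: d_def rp \<epsilon>p)
      finally have "(1 + N) / \<epsilon> \<le> (b - a) / d" using d by (simp add: pos_le_divide_eq)
      moreover have "1 \<le> 1 / \<epsilon>" using \<epsilon> by simp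
      ultimately show ?thesis unfolding u_def add_divide_distrib by linarith
    qed
    have parts: "2 * K * L / (c * \<epsilon>) + 2 * (1 + \<gamma>) / (1 - \<gamma>) + 3 \<le> N / \<epsilon>"
    proof -
      have "v \<le> v / \<epsilon>" if "0 < v" for v using \<epsilon> that by (simp add: le_divide_eq_1 field_simps)
      from this[of "2 * (1 + \<gamma>) / (1 - \<gamma>)"] this[of 3] N_parts show ?thesis
        by (simp add: N_def add_divide_distrib)
    qed
    have pos: "0 < 2 * K * L / (c * \<epsilon>)" using K L c \<epsilon> by simp
    define k where "k = nat \<lfloor>u\<rfloor>"
    have u0: "0 \<le> u" using u_ge parts pos N_parts by linarith
    have ku: "real k \<le> u" "u < real k + 1" using u0 by (auto simp: k_def)
    have k0: "0 < real k" using ku u_ge parts pos N_parts by linarith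
    \<comment> \<open>The ideal step \<open>d\<close> is stretched so that exactly \<open>k\<close>
      steps end at time \<open>b - d\<close>. The excess is at most \<open>d / k\<close>, which
      \<open>avgW_step\<close> tolerates for
      \<open>k \<ge> 2 * (1 + \<gamma>) / (1 - \<gamma>)\<close>.\<close>
    define \<tau> where "\<tau> = u / k * d"
    have k\<tau>: "a + k * \<tau> + d = b" using k0 d by (simp add: \<tau>_def u_def field_simps)
    have \<tau>: "\<bar>\<tau> - d\<bar> \<le> (1 - \<gamma>) * r powr p / 2"
    proof -
      have "2 * (1 + \<gamma>) / (1 - \<gamma>) \<le> k" using ku u_ge parts pos by linarith
      then have kk: "2 * (1 + \<gamma>) \<le> k * (1 - \<gamma>)" using \<gamma> by (simp add: pos_divide_le_eq)
      have "\<tau> - d = (u - k) * d / k" using k0 by (simp add: \<tau>_def field_simps)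
      moreover have "0 \<le> (u - k) * d / k" using ku d by simp
      moreover have "(u - k) * d / k \<le> 1 * d / k"
        using ku d by (intro divide_right_mono mult_right_mono) auto
      moreover have "1 * d / k \<le> (1 - \<gamma>) * r powr p / 2"
      proof -
        have "2 * (1 + \<gamma>) * r powr p \<le> k * (1 - \<gamma>) * r powr p" using kk by (intro mult_right_mono) auto
        then show ?thesis using k0 by (simp add: d_def field_simps)
      qed
      ultimately show ?thesis by linarith
    qed
    \<comment> \<open>Chain steps of length at most \<open>L * s = c * r\<close> are those that
      \<open>avgW_step\<close> allows.\<close>
    define s where "s = c * r / L"
    have s: "0 < s" using c r L by (simp add: s_def)
    obtain w where w: "w 0 = x" "\<And>i. \<rho> (w i) (w (Suc i)) \<le> L * s"
      "\<And>i::nat. \<rho> x y / s + 1 \<le> i \<Longrightarrow> w i = y"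
      using chain[OF s, of x y] by blast
    have walk: "avgW x r a \<le> C\<^sub>0 ^ i * avgW (w i) r (a + i * \<tau>)" for i
    proof (induction i)
      case (Suc i)
      have "avgW (w i) r (a + i * \<tau>) \<le> C\<^sub>0 * avgW (w (Suc i)) r (a + Suc i * \<tau>)"
        using w(2)[of i] \<tau> L by (intro step r) (auto simp: s_def d_def algebra_simps)
      then have "C\<^sub>0 ^ i * avgW (w i) r (a + i * \<tau>)
          \<le> C\<^sub>0 ^ i * (C\<^sub>0 * avgW (w (Suc i)) r (a + Suc i * \<tau>))"
        using C0 by (intro mult_left_mono) auto
      with Suc show ?case by (simp add: mult.assoc mult.left_commute)
    qed (simp add: w)
    have "\<rho> x y / s + 1 \<le> k"
    proof -
      have "\<rho> x y \<le> K * (\<rho> x z + \<rho> z y)" by (rule K)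
      also have "\<dots> \<le> K * (l + l)"
        using x y K(1) by (intro mult_left_mono) (auto simp: qball_def sym)
      finally have "\<rho> x y / s \<le> K * (l + l) / s" using s by (intro divide_right_mono) auto
      also have "\<dots> = 2 * K * L / (c * \<epsilon>)" using l L c \<epsilon> by (simp add: s_def r_def field_simps)
      finally show ?thesis using ku u_ge parts N_parts by linarith
    qed
    then have "w k = y" by (rule w(3))
    then have "avgW x r a \<le> C\<^sub>0 ^ k * avgW y r (a + k * \<tau>)" using walk[of k] by simp
    then have "avgW x r a * avgS y r b powr (q - 1)
        \<le> C\<^sub>0 ^ k * avgW y r (a + k * \<tau>) * avgS y r b powr (q - 1)"
      by (intro mult_right_mono) auto
    also have "\<dots> = C\<^sub>0 ^ k * (avgW y r (a + k * \<tau>) * avgS y r b powr (q - 1))" by simp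
    also have "\<dots> \<le> C\<^sub>0 ^ k * A"
      using slab_bound[OF r, of y "a + k * \<tau>"] C0 k\<tau> by (intro mult_left_mono) (auto simp: d_def)
    also have "\<dots> \<le> C\<^sub>0 ^ n * A"
    proof -
      have "u \<le> (b - a) / d" by (simp add: u_def)
      also have "\<dots> \<le> 2 * l powr p / d" using T2 d by (intro divide_right_mono) auto
      also have "\<dots> = 2 / ((1 + \<gamma>) * \<epsilon> powr p)" using l by (simp add: d_def rp)
      finally have "u \<le> 2 / ((1 + \<gamma>) * \<epsilon> powr p)" .
      then have "real k \<le> 2 / ((1 + \<gamma>) * \<epsilon> powr p)" using ku by linarith
      then have "k \<le> n" unfolding n_def by linarith
      then show ?thesis using C0 A by (intro mult_right_mono power_increasing) auto
    qed
    finally show ?thesis by (simp add: r_def)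
  qed
  moreover have "1 \<le> C\<^sub>0 ^ n * A"
  proof -
    have "1 * 1 \<le> C\<^sub>0 ^ n * A" using C0 A by (intro mult_mono) auto
    then show ?thesis by simp
  qed
  ultimately show ?thesis using \<epsilon> by (intro that[of \<epsilon> "C\<^sub>0 ^ n * A"]) auto
qed

section \<open>Passage from small slabs to whole cylinder parts\<close>

text \<open>Finitely many small balls times finitely many initial times cover the box, in a number
  independent of \<open>x\<close>, \<open>l\<close> and \<open>\<alpha>\<close>, and each slab is at
  most a fixed multiple of the box in volume. The measure \<open>M\<close> is left open because both
  \<open>W\<close> and \<open>S\<close> are estimated in this way.\<close>

lemma box_cover:
  assumes \<epsilon>: "0 < \<epsilon>" "\<epsilon> \<le> 1" and \<theta>: "0 < \<theta>"
  obtains \<Gamma> where "0 < \<Gamma>"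
    "\<And>M x l \<alpha> m. sets M = sets ST \<Longrightarrow> 0 < l \<Longrightarrow> 0 \<le> m \<Longrightarrow>
      (\<And>y a. y \<in> qball \<rho> x l \<Longrightarrow> \<alpha> \<le> a \<Longrightarrow> a < \<alpha> + \<theta> * l powr p \<Longrightarrow>
        emeasure M (slab y (\<epsilon> * l) a) \<le> ennreal (m * slab_vol y (\<epsilon> * l))) \<Longrightarrow>
      emeasure M (box x l \<alpha> (\<alpha> + \<theta> * l powr p)) \<le> ennreal (\<Gamma> * m * (vol x l * (\<theta> * l powr p)))"
proof -
  obtain K where K: "1 \<le> K" "\<And>x y z. \<rho> x y \<le> K * (\<rho> x z + \<rho> z y)" using quasi_triangleE by blast
  obtain D where D: "1 \<le> D" "\<And>x r. 0 < r \<Longrightarrow> vol x ((2 * K) * r) \<le> D * vol x r"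
    using vol_dilation by blast
  obtain N :: nat where cover: "\<And>x l. 0 < l \<Longrightarrow> \<exists>F. finite F \<and> card F \<le> N \<and> F \<subseteq> qball \<rho> x l \<and>
    qball \<rho> x l \<subseteq> (\<Union>y\<in>F. qball \<rho> y (\<epsilon> * l))"
    using bounded_cover[OF \<epsilon>] by blast
  define \<kappa> where "\<kappa> = (1 - \<gamma>) * \<epsilon> powr p"
  have \<kappa>: "0 < \<kappa>" using \<gamma> \<epsilon> by (simp add: \<kappa>_def)
  \<comment> \<open>This counts the initial times in an interval of length
    \<open>\<theta> * l powr p\<close> at a spacing of half the slab length.\<close>
  define n where "n = nat \<lceil>\<theta> / (\<kappa> / 2)\<rceil>"
  \<comment> \<open>The added \<open>1\<close> makes positivity of \<open>\<Gamma>\<close>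
    immediate.\<close>
  define \<Gamma> where "\<Gamma> = (real N * real n + 1) * (D * \<kappa> / \<theta>)"
  have \<Gamma>: "0 < \<Gamma>"
    unfolding \<Gamma>_def using D(1) \<kappa> \<theta> by (intro mult_pos_pos divide_pos_pos add_nonneg_pos) auto
  have "emeasure M (box x l \<alpha> (\<alpha> + \<theta> * l powr p)) \<le> ennreal (\<Gamma> * m * (vol x l * (\<theta> * l powr p)))"
    if M: "sets M = sets ST" and l: "0 < l" and m: "0 \<le> m" and
      bound: "\<And>y a. y \<in> qball \<rho> x l \<Longrightarrow> \<alpha> \<le> a \<Longrightarrow> a < \<alpha> + \<theta> * l powr p \<Longrightarrow>
        emeasure M (slab y (\<epsilon> * l) a) \<le> ennreal (m * slab_vol y (\<epsilon> * l))" for M x l \<alpha> m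
  proof -
    obtain F where F: "finite F" "card F \<le> N" "F \<subseteq> qball \<rho> x l"
      "qball \<rho> x l \<subseteq> (\<Union>y\<in>F. qball \<rho> y (\<epsilon> * l))"
      using cover[OF l, of x] by blast
    define h where "h = \<kappa> * l powr p"
    have h: "0 < h" using \<kappa> l by (simp add: h_def)
    have r: "0 < \<epsilon> * l" and rl: "\<epsilon> * l \<le> l" using \<epsilon> l by auto
    have h_eq: "(1 - \<gamma>) * (\<epsilon> * l) powr p = h" using \<epsilon> l by (simp add: h_def \<kappa>_def powr_mult)
    define t where "t i = \<alpha> + real i * (h / 2)" for i :: nat
    have t: "\<alpha> \<le> t i" "t i < \<alpha> + \<theta> * l powr p" if "i < n" for i
    proof -
      show "\<alpha> \<le> t i" using h by (simp add: t_def)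
      have "real i < \<theta> / (\<kappa> / 2)" using that unfolding n_def by linarith
      then have "real i * (\<kappa> / 2) < \<theta>" using \<kappa> by (simp add: field_simps)
      then have "real i * (\<kappa> / 2) * l powr p < \<theta> * l powr p" using l by simp
      then show "t i < \<alpha> + \<theta> * l powr p" by (simp add: t_def h_def)
    qed
    have sub: "box x l \<alpha> (\<alpha> + \<theta> * l powr p) \<subseteq> (\<Union>(y, i)\<in>F \<times> {..<n}. slab y (\<epsilon> * l) (t i))"
    proof clarify
      fix z \<tau> assume "(z, \<tau>) \<in> box x l \<alpha> (\<alpha> + \<theta> * l powr p)"
      then have z: "z \<in> qball \<rho> x l" and \<tau>: "\<alpha> < \<tau>" "\<tau> < \<alpha> + \<theta> * l powr p"
        by (auto simp: box_def)
      obtain y where y: "y \<in> F" "z \<in> qball \<rho> y (\<epsilon> * l)" using F(4) z by blast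
      define v where "v = (\<tau> - \<alpha>) / (h / 2)"
      have v0: "0 < v" using \<tau> h by (simp add: v_def)
      have "v < \<theta> * l powr p / (h / 2)"
        unfolding v_def using \<tau> h by (intro divide_strict_right_mono) auto
      also have "\<dots> = \<theta> / (\<kappa> / 2)" using l by (simp add: h_def)
      finally have vn: "v < \<theta> / (\<kappa> / 2)" .
      \<comment> \<open>Slabs are open in time, so the initial time must lie strictly before
        \<open>\<tau>\<close>; the floor of \<open>v\<close> would fail at integers. The half-length
        spacing keeps the other end strict as well.\<close>
      define i where "i = nat (\<lceil>v\<rceil> - 1)"
      have i: "real i < v" "v \<le> real i + 1" using v0 unfolding i_def by linarith+
      have "i < n" using i vn unfolding n_def by linarith
      moreover have "t i < \<tau>" "\<tau> < t i + h"
      proof -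
        have "v * (h / 2) = \<tau> - \<alpha>" using h by (simp add: v_def)
        moreover have "real i * (h / 2) < v * (h / 2)" "v * (h / 2) \<le> (real i + 1) * (h / 2)"
          using i h by auto
        ultimately show "t i < \<tau>" "\<tau> < t i + h"
          unfolding t_def using h by (auto simp: algebra_simps)
      qed
      ultimately show "(z, \<tau>) \<in> (\<Union>(y, i)\<in>F \<times> {..<n}. slab y (\<epsilon> * l) (t i))"
        using y by (auto simp: slab_def box_def h_eq)
    qed
    have slab_le: "slab_vol y (\<epsilon> * l) \<le> D * vol x l * h" if "y \<in> F" for y
    proof -
      have xy: "\<rho> x y < l" using F(3) that by (auto simp: qball_def)
      have "qball \<rho> y (\<epsilon> * l) \<subseteq> qball \<rho> x (2 * K * l)"
      proof
        fix z assume "z \<in> qball \<rho> y (\<epsilon> * l)"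
        then have yz: "\<rho> y z < \<epsilon> * l" by (simp add: qball_def)
        have "\<rho> x z \<le> K * (\<rho> x y + \<rho> y z)" by (rule K)
        also have "\<dots> < K * (l + l)"
          using xy yz rl K(1) by (intro mult_strict_left_mono) auto
        finally show "z \<in> qball \<rho> x (2 * K * l)" by (simp add: qball_def)
      qed
      then have "vol y (\<epsilon> * l) \<le> vol x (2 * K * l)" using r l K(1) by (intro vol_mono) auto
      also have "\<dots> \<le> D * vol x l" using D(2)[OF l] by simp
      finally show ?thesis unfolding slab_vol_def h_eq using h by (intro mult_right_mono) auto
    qed
    have slab_M: "slab y (\<epsilon> * l) (t i) \<in> sets M" for y i
      unfolding M using r by (rule slab_sets)
    have "emeasure M (box x l \<alpha> (\<alpha> + \<theta> * l powr p))
        \<le> emeasure M (\<Union>(y, i)\<in>F \<times> {..<n}. slab y (\<epsilon> * l) (t i))"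
      by (intro emeasure_mono sub sets.finite_UN) (use F(1) slab_M in \<open>auto split: prod.split\<close>)
    also have "\<dots> \<le> (\<Sum>yi\<in>F \<times> {..<n}. emeasure M (case yi of (y, i) \<Rightarrow> slab y (\<epsilon> * l) (t i)))"
      by (intro emeasure_subadditive_finite) (use F(1) slab_M in \<open>auto split: prod.split\<close>)
    also have "\<dots> \<le> (\<Sum>yi\<in>F \<times> {..<n}. ennreal (m * (D * vol x l * h)))"
    proof (intro sum_mono)
      fix yi assume "yi \<in> F \<times> {..<n}"
      then obtain y i where yi: "yi = (y, i)" "y \<in> F" "i < n" by auto
      have "emeasure M (slab y (\<epsilon> * l) (t i)) \<le> ennreal (m * slab_vol y (\<epsilon> * l))"
        using yi F(3) t[of i] by (intro bound) auto
      also have "\<dots> \<le> ennreal (m * (D * vol x l * h))"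
        using slab_le[OF yi(2)] m by (intro ennreal_leI mult_left_mono)
      finally show "emeasure M (case yi of (y, i) \<Rightarrow> slab y (\<epsilon> * l) (t i)) \<le> \<dots>"
        by (simp add: yi)
    qed
    also have "\<dots> = ennreal (real (card F * n) * (m * (D * vol x l * h)))"
      by (simp add: card_cartesian_product ennreal_of_nat_eq_real_of_nat flip: ennreal_mult')
    also have "\<dots> \<le> ennreal ((real N * real n + 1) * (m * (D * vol x l * h)))"
    proof (intro ennreal_leI mult_right_mono)
      have "card F * n \<le> N * n" using F(2) by simp
      then have "real (card F * n) \<le> real (N * n)" by (simp only: of_nat_le_iff)
      then show "real (card F * n) \<le> real N * real n + 1" by simp
    qed (use m D(1) h in auto)
    also have "(real N * real n + 1) * (m * (D * vol x l * h)) = \<Gamma> * m * (vol x l * (\<theta> * l powr p))"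
      using \<theta> by (simp add: \<Gamma>_def h_def)
    finally show ?thesis .
  qed
  then show ?thesis using \<Gamma> by (intro that) auto
qed

text \<open>The covering argument is applied twice. With one small upper slab fixed, covering the
  lower part bounds its average of \<open>\<omega>\<close>. Read the other way, this bounds the
  average of \<open>\<sigma>\<close> over every small upper slab in terms of \<open>P\<close>, and
  covering the upper part finishes the estimate.\<close>

lemma A_plus_bound_any_lag:
  assumes \<delta>: "0 < \<delta>" "\<delta> < 1"
  obtains B where "\<And>x t l. 0 < l \<Longrightarrow>
    average ST (cylinder_minus p \<rho> \<delta> x t l) \<omega> *
    ennreal_power (average ST (cylinder_plus p \<rho> \<delta> x t l) (\<lambda>z. \<omega> z powr (1 - conj_exponent q))) (q - 1)
      \<le> ennreal B"
proof -
  obtain \<epsilon> C where \<epsilon>: "0 < \<epsilon>" "\<epsilon> \<le> 1" and C: "1 \<le> C" and far: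
    "\<And>x y z l a b. 0 < l \<Longrightarrow> x \<in> qball \<rho> z l \<Longrightarrow> y \<in> qball \<rho> z l \<Longrightarrow>
      2 * \<delta> * l powr p \<le> b - a \<Longrightarrow> b - a \<le> 2 * l powr p \<Longrightarrow>
      avgW x (\<epsilon> * l) a * avgS y (\<epsilon> * l) b powr (q - 1) \<le> C"
    using avg_far[OF \<delta>(1)] by blast
  define \<theta> where "\<theta> = 1 - \<delta>"
  have \<theta>: "0 < \<theta>" using \<delta> by (simp add: \<theta>_def)
  obtain \<Gamma> where \<Gamma>: "0 < \<Gamma>" and cover:
    "\<And>M x l \<alpha> m. sets M = sets ST \<Longrightarrow> 0 < l \<Longrightarrow> 0 \<le> m \<Longrightarrow>
      (\<And>y a. y \<in> qball \<rho> x l \<Longrightarrow> \<alpha> \<le> a \<Longrightarrow> a < \<alpha> + \<theta> * l powr p \<Longrightarrow>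
        emeasure M (slab y (\<epsilon> * l) a) \<le> ennreal (m * slab_vol y (\<epsilon> * l))) \<Longrightarrow>
      emeasure M (box x l \<alpha> (\<alpha> + \<theta> * l powr p)) \<le> ennreal (\<Gamma> * m * (vol x l * (\<theta> * l powr p)))"
    using box_cover[OF \<epsilon> \<theta>] by blast
  have "average ST (cylinder_minus p \<rho> \<delta> x t l) \<omega> *
      ennreal_power (average ST (cylinder_plus p \<rho> \<delta> x t l) (\<lambda>z. \<omega> z powr (1 - conj_exponent q))) (q - 1)
      \<le> ennreal (\<Gamma> powr q * C)" if l: "0 < l" for x t l
  proof -
    have r: "0 < \<epsilon> * l" using \<epsilon> l by simp
    define V where "V = vol x l * (\<theta> * l powr p)"
    have V: "0 < V" using vol_pos[OF l] \<theta> l by (simp add: V_def)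
    define \<alpha> where "\<alpha> = t - l powr p"
    define \<beta> where "\<beta> = t + \<delta> * l powr p"
    define Rm where "Rm = box x l \<alpha> (\<alpha> + \<theta> * l powr p)"
    define Rp where "Rp = box x l \<beta> (\<beta> + \<theta> * l powr p)"
    have Rm: "cylinder_minus p \<rho> \<delta> x t l = Rm"
      by (simp add: cylinder_minus_def Rm_def box_def \<alpha>_def \<theta>_def algebra_simps)
    have Rp: "cylinder_plus p \<rho> \<delta> x t l = Rp"
      by (simp add: cylinder_plus_def Rp_def box_def \<beta>_def \<theta>_def algebra_simps)
    have meas: "Rm \<in> sets ST" "Rp \<in> sets ST" "emeasure ST Rm = ennreal V" "emeasure ST Rp = ennreal V"
      using emeasure_box[OF l] l \<theta> by (simp_all add: Rm_def Rp_def V_def)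
    \<comment> \<open>Initial times below lie in
      \<open>[t - l powr p, t - \<delta> * l powr p)\<close> and those above in
      \<open>[t + \<delta> * l powr p, t + l powr p)\<close>, so their gap is in the range required
      by \<open>far\<close>.\<close>
    have far': "avgW y (\<epsilon> * l) a * avgS y' (\<epsilon> * l) b powr (q - 1) \<le> C"
      if "y \<in> qball \<rho> x l" "\<alpha> \<le> a" "a < \<alpha> + \<theta> * l powr p"
        "y' \<in> qball \<rho> x l" "\<beta> \<le> b" "b < \<beta> + \<theta> * l powr p" for y a y' b
      using that by (intro far[OF l that(1,4)]) (auto simp: \<alpha>_def \<beta>_def \<theta>_def algebra_simps)
    define P where "P = measure W Rm / V"
    have W_le: "emeasure W Rm \<le> ennreal (\<Gamma> * (C / avgS y (\<epsilon> * l) b powr (q - 1)) * V)"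
      if "y \<in> qball \<rho> x l" "\<beta> \<le> b" "b < \<beta> + \<theta> * l powr p" for y b
      unfolding Rm_def V_def
    proof (intro cover l)
      fix y' a assume y': "y' \<in> qball \<rho> x l" "\<alpha> \<le> a" "a < \<alpha> + \<theta> * l powr p"
      have "avgW y' (\<epsilon> * l) a \<le> C / avgS y (\<epsilon> * l) b powr (q - 1)"
        using far'[OF y' that] avg_pos(2)[OF r, of y b] by (simp add: field_simps)
      then show "emeasure W (slab y' (\<epsilon> * l) a)
          \<le> ennreal (C / avgS y (\<epsilon> * l) b powr (q - 1) * slab_vol y' (\<epsilon> * l))"
        unfolding emeasure_slab_weights[OF r]
        using slab_vol_pos[OF r, of y'] by (intro ennreal_leI mult_right_mono) auto
    qed (use C in auto)
    have "x \<in> qball \<rho> x l" using l eq_0_iff[of x x] by (simp add: qball_def)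
    moreover have \<theta>l: "\<beta> < \<beta> + \<theta> * l powr p" using \<theta> l by simp
    ultimately have "emeasure W Rm < \<infinity>" using W_le[of x \<beta>] by (auto intro: le_less_trans)
    then have WP: "emeasure W Rm = ennreal (P * V)"
      using V by (simp add: P_def emeasure_eq_ennreal_measure)
    have "emeasure W Rm \<noteq> 0"
      unfolding W_def using meas V by (intro emeasure_density_pos \<omega>_measurable \<omega>_pos) auto
    then have P: "0 < P" 
      unfolding WP using V by (simp add: ennreal_eq_0_iff not_le zero_less_mult_iff)
    \<comment> \<open>The value is the solution of \<open>Q powr (q - 1) = \<Gamma> * C / P\<close>,
      the largest average of \<open>\<sigma>\<close> compatible with the bound on
      \<open>P\<close>.\<close>
    define Q where "Q = (\<Gamma> * C / P) powr (1 / (q - 1))"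
    have S_le: "emeasure S Rp \<le> ennreal (\<Gamma> * Q * V)"
      unfolding Rp_def V_def
    proof (intro cover l)
      fix y b assume y: "y \<in> qball \<rho> x l" "\<beta> \<le> b" "b < \<beta> + \<theta> * l powr p"
      define s where "s = avgS y (\<epsilon> * l) b"
      have s: "0 < s" using avg_pos(2)[OF r] by (simp add: s_def)
      have "P * V \<le> \<Gamma> * (C / s powr (q - 1)) * V"
        using W_le[OF y] \<Gamma> C V by (simp add: WP s_def)
      then have "P \<le> \<Gamma> * (C / s powr (q - 1))"
        using V by (simp only: mult_le_cancel_right_pos)
      then have "s powr (q - 1) \<le> \<Gamma> * C / P" using P s by (simp add: field_simps)
      then have "(s powr (q - 1)) powr (1 / (q - 1)) \<le> Q"
        unfolding Q_def using q by (intro powr_mono2) auto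
      then have "s \<le> Q" using q s by (simp add: powr_powr)
      then show "emeasure S (slab y (\<epsilon> * l) b) \<le> ennreal (Q * slab_vol y (\<epsilon> * l))"
        unfolding emeasure_slab_weights[OF r] s_def
        using slab_vol_pos[OF r, of y] by (intro ennreal_leI mult_right_mono) auto
    qed (auto simp: Q_def)
    define Z where "Z = measure S Rp / V"
    have "emeasure S Rp < \<infinity>" using S_le by (auto intro: le_less_trans)
    then have SZ: "emeasure S Rp = ennreal (Z * V)"
      using V by (simp add: Z_def emeasure_eq_ennreal_measure)
    have Z0: "0 \<le> Z" using V by (simp add: Z_def)
    have Q0: "0 \<le> Q" by (simp add: Q_def)
    have "Z \<le> \<Gamma> * Q" using S_le V \<Gamma> Q0 by (simp add: SZ)
    then have "P * Z powr (q - 1) \<le> P * (\<Gamma> * Q) powr (q - 1)"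
      using P Z0 q by (intro mult_left_mono powr_mono2) auto
    also have "(\<Gamma> * Q) powr (q - 1) = \<Gamma> powr (q - 1) * (\<Gamma> * C / P)"
      using \<Gamma> Q0 q C P by (simp add: powr_mult Q_def powr_powr)
    \<comment> \<open>Here \<open>P\<close> cancels, and a constant independent of the cylinder
      remains.\<close>
    also have "P * \<dots> = \<Gamma> powr q * C" using P \<Gamma> by (simp add: powr_diff)
    finally have "P * Z powr (q - 1) \<le> \<Gamma> powr q * C" .
    then show ?thesis
      unfolding Rm Rp using P Z0 V meas
      by (simp add: average_\<omega> average_\<sigma> WP SZ divide_ennreal ennreal_power_def ennreal_leI
          flip: ennreal_mult)
  qed
  then show ?thesis by (rule that)
qed

end

section \<open>Inclusions between the weight classes\<close>

lemma A_plus_subset: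
  assumes "homogeneous_type_space \<rho> \<mu>" "basic_assumptions \<rho> \<mu>" "monotone_geodesic \<rho>"
    and "1 < p" "1 < q" "0 \<le> \<gamma>" "\<gamma> < 1" "0 < \<gamma>'" "\<gamma>' < 1"
  shows "A_plus p \<rho> \<mu> q \<gamma> \<subseteq> A_plus p \<rho> \<mu> q \<gamma>'"
proof
  fix \<omega> assume \<omega>: "\<omega> \<in> A_plus p \<rho> \<mu> q \<gamma>"
  define f where "f \<delta> = (\<lambda>(x, t, l). average (spacetime_measure \<mu>) (cylinder_minus p \<rho> \<delta> x t l) \<omega> *
        ennreal_power
          (average (spacetime_measure \<mu>) (cylinder_plus p \<rho> \<delta> x t l)
            (\<lambda>z. \<omega> z powr (1 - conj_exponent q)))
          (q - 1))" for \<delta>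
  have w: "weight p \<rho> \<mu> \<omega>" and fin: "(SUP z \<in> UNIV \<times> UNIV \<times> {0<..}. f \<gamma> z) < \<infinity>"
    using \<omega> by (auto simp: A_plus_def f_def)
  obtain A where A: "(SUP z \<in> UNIV \<times> UNIV \<times> {0<..}. f \<gamma> z) = ennreal A"
    using fin by (cases "SUP z \<in> UNIV \<times> UNIV \<times> {0<..}. f \<gamma> z") auto
  \<comment> \<open>Raising the supremum to at least \<open>1\<close> fits the locale, where
    constants of at least \<open>1\<close> stay so under multiplication.\<close>
  have bound: "f \<gamma> (x, t, l) \<le> ennreal (max 1 A)" if "0 < l" for x t l
  proof -
    have "f \<gamma> (x, t, l) \<le> ennreal A" unfolding A[symmetric] using that by (intro SUP_upper) auto
    also have "\<dots> \<le> ennreal (max 1 A)" by (intro ennreal_leI) auto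
    finally show ?thesis .
  qed
  interpret H: homogeneous_type_space \<rho> \<mu> by fact
  interpret B: basic_assumptions \<rho> \<mu> by fact
  interpret one_sided_weight \<rho> \<mu> p q \<gamma> "max 1 A" \<omega>
    by unfold_locales (use assms w bound in \<open>auto simp: f_def\<close>)
  obtain B where B: "\<And>x t l. 0 < l \<Longrightarrow> f \<gamma>' (x, t, l) \<le> ennreal B"
    using A_plus_bound_any_lag[of \<gamma>'] assms unfolding f_def by auto
  then have "(SUP z \<in> UNIV \<times> UNIV \<times> {0<..}. f \<gamma>' z) \<le> ennreal B" by (intro SUP_least) auto
  also have "\<dots> < \<infinity>" by simp
  finally show "\<omega> \<in> A_plus p \<rho> \<mu> q \<gamma>'" using w by (simp add: A_plus_def f_def)
qed

theorem theorem4p1: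
  fixes \<rho> :: "'a \<Rightarrow> 'a \<Rightarrow> real" and \<mu> :: "'a measure" and p q \<gamma> \<gamma>' :: real
  assumes "homogeneous_type_space \<rho> \<mu>"
    and "basic_assumptions \<rho> \<mu>"
    and "monotone_geodesic \<rho>"
    and "1 < p"
    and "basic_assumptions (parabolic_dist p \<rho>) (spacetime_measure \<mu>)"
    and "1 < q"
    and "\<gamma> \<in> {0..<1}" and "\<gamma>' \<in> {0..<1}"
  shows "(0 \<le> \<gamma> \<and> \<gamma> \<le> \<gamma>' \<and> \<gamma>' < 1 \<longrightarrow> A_plus p \<rho> \<mu> q \<gamma> \<subseteq> A_plus p \<rho> \<mu> q \<gamma>') \<and>
         (0 < \<gamma>' \<and> \<gamma>' < \<gamma> \<and> \<gamma> < 1 \<longrightarrow> A_plus p \<rho> \<mu> q \<gamma> \<subseteq> A_plus p \<rho> \<mu> q \<gamma>')"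
  using A_plus_subset[OF assms(1-4,6), of \<gamma> \<gamma>'] assms(7,8)
  \<comment> \<open>A target lag of \<open>0\<close> occurs only in the first inclusion and forces
    \<open>\<gamma> = 0\<close>; positive target lags fall under
    \<open>A_plus_subset\<close>.\<close>
  by (cases "\<gamma>' = 0") auto

end
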